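(* Let $n\ge 1$. For every integer $i$ with $1\le i\le n!$, $$c_{n,i} = \sum_{d\mid i}\left[\binom{n-1}{d-1}\left(\sum_{j\mid \frac{i}{d}} c_{d-1,j}\, c_{n-d,\frac{i}{dj}}\right)\right],$$ where the sums run over positive divisors, and $c_{n,i}=0$ for all other $i$.
   Context: Write $[n]=\{1,\dots,n\}$. A street has parking spots $1,\dots,n$ in order, and cars $c_1,\dots,c_n$ arrive in this order. Given $\alpha=(a_1,\dots,a_n)\in[n]^n$, car $c_i$ drives to its preferred spot $a_i$ and parks there if it is empty; otherwise it continues forward and parks in the first empty spot after $a_i$, if there is one (otherwise it fails to park). The tuple $\alpha$ is a parking function of length $n$ if all $n$ cars park; $PF_n$ is the set of parking functions of length $n$. The map $\varphi:PF_n\to S_n$ sends $\alpha$ to the permutation $s_1s_2\cdots s_n$ (one-line notation), where spot $i$ is occupied by car $c_{s_i}$ after all cars have parked. For $n\ge 0$, the coefficient $c_{n,i}$ is the number of permutations $\sigma\in S_n$ with $|\varphi^{-1}(\sigma)|=i$. For $n=0$ there is one (empty) permutation and one (empty) parking function, so $c_{0,1}=1$ and $c_{0,i}=0$ for $i\neq 1$. By convention $c_{n,i}=0$ if $n<0$. *)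

theory Defs
  imports Complex_Main "HOL-Library.FuncSet" "HOL-Combinatorics.Permutations"
begin

text \<open>
  A state of the street with spots \<open>1, \<dots>, n\<close> is a partial map from spots to the indices
  of the cars occupying them. A car that finds no empty spot leaves the state unchanged.
\<close>

definition park_car :: "nat \<Rightarrow> nat \<Rightarrow> nat \<Rightarrow> (nat \<rightharpoonup> nat) \<Rightarrow> (nat \<rightharpoonup> nat)" where
  "park_car n car pref st =
     (if \<exists>s. pref \<le> s \<and> s \<le> n \<and> st s = None
      then st((LEAST s. pref \<le> s \<and> s \<le> n \<and> st s = None) \<mapsto> car)
      else st)"

text \<open>\<open>park n \<alpha> k\<close> is the state after the arrival of cars \<open>1, \<dots>, k\<close>, in this order.\<close>

primrec park :: "nat \<Rightarrow> (nat \<Rightarrow> nat) \<Rightarrow> nat \<Rightarrow> (nat \<rightharpoonup> nat)" where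
  "park n \<alpha> 0 = Map.empty"
| "park n \<alpha> (Suc k) = park_car n (Suc k) (\<alpha> (Suc k)) (park n \<alpha> k)"

text \<open>
  Tuples in \<open>[n]\<^sup>n\<close> are extensional functions, so that distinct elements of the set
  below are distinct tuples.
\<close>

definition PF :: "nat \<Rightarrow> (nat \<Rightarrow> nat) set" where
  "PF n = {\<alpha> \<in> {1..n} \<rightarrow>\<^sub>E {1..n}. \<forall>car\<in>{1..n}. \<exists>s\<in>{1..n}. park n \<alpha> n s = Some car}"

text \<open>
  The outcome \<open>s\<^sub>1 s\<^sub>2 \<dots> s\<^sub>n\<close> sends spot \<open>i\<close> to the index of the car parked there. Outside
  \<open>{1..n}\<close> it is the identity, in accordance with \<^const>\<open>permutes\<close>.
\<close>

definition outcome :: "nat \<Rightarrow> (nat \<Rightarrow> nat) \<Rightarrow> (nat \<Rightarrow> nat)" where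
  "outcome n \<alpha> = (\<lambda>i. if i \<in> {1..n} then the (park n \<alpha> n i) else i)"

definition outcome_fiber :: "nat \<Rightarrow> (nat \<Rightarrow> nat) \<Rightarrow> (nat \<Rightarrow> nat) set" where
  "outcome_fiber n \<sigma> = {\<alpha> \<in> PF n. outcome n \<alpha> = \<sigma>}"

text \<open>Both indices are integers, because of the convention for negative \<open>n\<close>.\<close>

definition c :: "int \<Rightarrow> int \<Rightarrow> nat" where
  "c n i =
     (if n < 0 then 0
      else card {\<sigma>. \<sigma> permutes {1..nat n} \<and> int (card (outcome_fiber (nat n) \<sigma>)) = i})"

end

theory Submission
  imports Defs "HOL-Library.Infinite_Set" "HOL-Combinatorics.Multiset_Permutations"
begin

text \<open>
  A car of final position \<open>p\<close> may prefer any spot \<open>a \<le> p\<close> such that no spot in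
  \<open>{a..p}\<close> is taken by a later car, and these choices are independent for different cars.
  Hence the fibre of \<open>\<sigma>\<close> has \<open>\<Prod>\<^sub>p \<ell>\<^sub>p\<close> elements, where \<open>\<ell>\<^sub>p\<close> is the length of the longest
  block of spots ending in \<open>p\<close> with values at most \<open>\<sigma> p\<close>. If the last car \<open>n\<close> parks in spot
  \<open>d\<close>, then \<open>\<ell>\<^sub>d = d\<close>, and no block of another spot contains \<open>d\<close>; so the product splits
  into \<open>d\<close> and the products for the words to the left and to the right of \<open>d\<close>. These depend
  only on the relative order of the letters, and the letters on the left can be chosen in
  \<open>(n - 1) choose (d - 1)\<close> ways.
\<close>

section \<open>Weights of words\<close>

text \<open>Words are read from right to left, so that the blocks become prefixes.\<close>

primrec weight :: "nat list \<Rightarrow> nat" where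
  "weight [] = 1"
| "weight (x # xs) = Suc (length (takeWhile (\<lambda>y. y \<le> x) xs)) * weight xs"

lemma weight_pos: "0 < weight xs"
  by (induction xs) auto

text \<open>Each factor is at most the length of the suffix that it starts. The bound later shows
  that \<open>c\<close> vanishes above the factorial.\<close>

lemma weight_le_fact: "weight xs \<le> fact (length xs)"
proof (induction xs)
  case (Cons x xs)
  have "Suc (length (takeWhile (\<lambda>y. y \<le> x) xs)) \<le> Suc (length xs)"
    by (simp add: length_takeWhile_le)
  then show ?case
    using mult_le_mono[OF _ Cons.IH] by (auto simp del: mult_Suc)
qed simp

text \<open>The block of \<open>m\<close> takes in all of \<open>zs\<close>, a block starting in
  \<open>ys\<close> stops before \<open>m\<close>, and a block starting in \<open>zs\<close> never
  sees what precedes it. In street order \<open>zs\<close> lies to the left of \<open>m\<close>, so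
  \<open>Suc (length zs)\<close> is the spot of the maximum.\<close>

lemma weight_append_max:
  assumes "\<forall>y\<in>set ys. y < m" "\<forall>z\<in>set zs. z < m"
  shows "weight (ys @ m # zs) = Suc (length zs) * weight zs * weight ys"
  using assms(1)
proof (induction ys)
  case Nil
  have "takeWhile (\<lambda>y. y \<le> m) zs = zs"
    using assms(2) by (auto simp: takeWhile_eq_all_conv)
  then show ?case by (simp del: takeWhile_eq_all_conv)
next
  case (Cons y ys)
  have "takeWhile (\<lambda>x. x \<le> y) (ys @ m # zs) = takeWhile (\<lambda>x. x \<le> y) ys"
    using Cons.prems by (induction ys) auto
  then show ?case
    using Cons by (simp del: mult_Suc)
qed

text \<open>The weight depends only on comparisons between letters, which \<open>f\<close>
  preserves.\<close>

lemma weight_map: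
  assumes "strict_mono_on A f" "set xs \<subseteq> A"
  shows "weight (map f xs) = weight xs"
  using assms(2)
proof (induction xs)
  case (Cons x xs)
  have "takeWhile (\<lambda>y. f y \<le> f x) xs = takeWhile (\<lambda>y. y \<le> x) xs"
    using Cons.prems by (intro takeWhile_cong refl) (auto simp: strict_mono_on_less_eq[OF assms(1)])
  then show ?case
    using Cons by (simp add: takeWhile_map o_def)
qed simp

section \<open>Counting the arrangements of a finite set by weight\<close>

definition weight_count :: "nat set \<Rightarrow> int \<Rightarrow> nat" where
  "weight_count A i = card {xs \<in> permutations_of_set A. int (weight xs) = i}"

text \<open>The increasing enumeration \<open>f\<close> of \<open>A\<close> carries arrangements of
  the index set to arrangements of \<open>A\<close> and keeps their weights.\<close>

lemma weight_count_lessThan_card: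
  assumes "finite A"
  shows "weight_count {..<card A} i = weight_count A i"
proof -
  obtain f where f: "bij_betw f {..<card A} A" "strict_mono_on {..<card A} f"
    using assms by (rule ex_bij_betw_strict_mono_card)
  have w: "weight (map f xs) = weight xs" if "xs \<in> permutations_of_set {..<card A}" for xs
    using permutations_of_setD(1)[OF that] by (intro weight_map[OF f(2)]) simp
  have perms: "permutations_of_set A = map f ` permutations_of_set {..<card A}"
    using f(1) permutations_of_set_image_inj[of f "{..<card A}"] by (simp add: bij_betw_def)
  have "inj_on (map f) (lists {..<card A})"
    using f(1) by (intro inj_on_mapI) (auto simp: bij_betw_def intro: inj_on_subset)
  then have inj: "inj_on (map f) {xs \<in> permutations_of_set {..<card A}. int (weight xs) = i}"
    by (rule inj_on_subset) (auto dest: permutations_of_setD(1))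
  have "{xs \<in> permutations_of_set A. int (weight xs) = i} =
      map f ` {xs \<in> permutations_of_set {..<card A}. int (weight xs) = i}"
    unfolding perms using w by auto
  then show ?thesis
    by (simp add: weight_count_def card_image[OF inj])
qed

lemma weight_count_eq:
  assumes "finite A"
  shows "weight_count A i = weight_count {1..card A} i"
  \<comment> \<open>Both sets are compared with the same initial segment
    \<open>{..<card A}\<close>.\<close>
  using weight_count_lessThan_card[OF assms] weight_count_lessThan_card[of "{1..card A}"] by simp

text \<open>Cutting a word at its only \<open>m\<close> leaves a set \<open>C\<close> of letters
  after \<open>m\<close> and two independent arrangements, of \<open>C\<close> and of
  \<open>B - C\<close>; \<open>weight_append_max\<close> gives the weight.\<close>

lemma weight_count_insert_max:
  assumes "finite B" "\<forall>b\<in>B. b < m"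
  shows "weight_count (insert m B) i =
    (\<Sum>C\<in>Pow B. card {(zs, ys) \<in> permutations_of_set C \<times> permutations_of_set (B - C).
       (int (card C) + 1) * int (weight zs) * int (weight ys) = i})"
proof -
  define S where "S C = {(zs, ys) \<in> permutations_of_set C \<times> permutations_of_set (B - C).
       (int (card C) + 1) * int (weight zs) * int (weight ys) = i}" for C
  define g where "g = (\<lambda>(C :: nat set, zs, ys). ys @ m # zs)"
  have m: "m \<notin> B" using assms(2) by auto
  have fin: "finite (S C)" for C
    unfolding S_def
    by (rule finite_subset[where B = "permutations_of_set C \<times> permutations_of_set (B - C)"]) auto
  have w: "int (weight (ys @ m # zs)) = (int (card C) + 1) * int (weight zs) * int (weight ys)"
    if "C \<subseteq> B" "zs \<in> permutations_of_set C" "ys \<in> permutations_of_set (B - C)" for C zs ys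
  proof -
    have "length zs = card C"
      using that(2) by (auto simp: permutations_of_set_def distinct_card)
    moreover have "\<forall>y\<in>set ys. y < m" "\<forall>z\<in>set zs. z < m"
      using that assms(2) by (auto simp: permutations_of_set_def)
    ultimately show ?thesis
      by (simp add: weight_append_max del: mult_Suc)
  qed
  \<comment> \<open>Neither part contains \<open>m\<close>, so the word determines the cut, and
    \<open>C\<close> is recovered as \<open>set zs\<close>.\<close>
  have "inj_on g (Sigma (Pow B) S)"
  proof (rule inj_onI)
    fix p q assume pq: "p \<in> Sigma (Pow B) S" "q \<in> Sigma (Pow B) S" and eq: "g p = g q"
    obtain C zs ys where p: "p = (C, zs, ys)" by (metis prod_cases3)
    obtain C' zs' ys' where q: "q = (C', zs', ys')" by (metis prod_cases3)
    have sets: "set zs = C" "set ys = B - C" "set zs' = C'" "set ys' = B - C'" "C \<subseteq> B" "C' \<subseteq> B"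
      using pq by (auto simp: p q S_def permutations_of_set_def)
    then have "m \<notin> set zs" "m \<notin> set ys" "m \<notin> set zs'" "m \<notin> set ys'"
      using m by auto
    then have "ys = ys' \<and> zs = zs'"
      using eq by (simp add: p q g_def append_Cons_eq_iff)
    then show "p = q" using sets by (simp add: p q)
  qed
  moreover have "g ` Sigma (Pow B) S = {xs \<in> permutations_of_set (insert m B). int (weight xs) = i}"
  proof (intro equalityI subsetI)
    fix xs assume "xs \<in> g ` Sigma (Pow B) S"
    then obtain C zs ys where C: "C \<subseteq> B" "(zs, ys) \<in> S C" and xs: "xs = ys @ m # zs"
      by (auto simp: g_def)
    have zy: "zs \<in> permutations_of_set C" "ys \<in> permutations_of_set (B - C)"
      using C(2) by (auto simp: S_def)
    have "xs \<in> permutations_of_set (insert m B)"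
      using zy C(1) m by (auto simp: permutations_of_set_def xs)
    moreover have "int (weight xs) = i"
      using w[OF C(1) zy] C(2) by (simp add: xs S_def)
    ultimately show "xs \<in> {xs \<in> permutations_of_set (insert m B). int (weight xs) = i}"
      by simp
  next
    fix xs assume "xs \<in> {xs \<in> permutations_of_set (insert m B). int (weight xs) = i}"
    then have xs: "set xs = insert m B" "distinct xs" "int (weight xs) = i"
      by (auto simp: permutations_of_set_def)
    then obtain ys zs where split: "xs = ys @ m # zs"
      by (metis insertI1 split_list)
    have C: "set zs \<subseteq> B" "zs \<in> permutations_of_set (set zs)"
      "ys \<in> permutations_of_set (B - set zs)"
      using xs(1,2) m by (auto simp: split permutations_of_set_def)
    then have "(zs, ys) \<in> S (set zs)"
      using w[OF C] xs(3) by (simp add: S_def split)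
    then show "xs \<in> g ` Sigma (Pow B) S"
      using C(1) by (intro image_eqI[where x = "(set zs, zs, ys)"]) (auto simp: g_def split)
  qed
  ultimately have "weight_count (insert m B) i = card (Sigma (Pow B) S)"
    unfolding weight_count_def using card_image by fastforce
  also have "\<dots> = (\<Sum>C\<in>Pow B. card (S C))"
    using assms(1) fin by (intro card_SigmaI) auto
  finally show ?thesis by (simp add: S_def)
qed

text \<open>Pairs are sorted by the weight \<open>j\<close> of \<open>zs\<close>. The weight of
  \<open>ys\<close> is then forced to be \<open>i div (d * j)\<close>, so each class is a cartesian
  product.\<close>

lemma card_weight_pairs:
  fixes d i :: int
  assumes "0 < d" "0 < i"
  shows "card {(zs, ys) \<in> permutations_of_set C \<times> permutations_of_set D.
       d * int (weight zs) * int (weight ys) = i} =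
    (if d dvd i
     then \<Sum>j | 0 < j \<and> j dvd i div d. weight_count C j * weight_count D (i div (d * j)) else 0)"
    (is "card ?S = _")
proof (cases "d dvd i")
  case False
  then have "?S = {}" by auto
  then show ?thesis using False by (simp only: card.empty if_False)
next
  case True
  then obtain e where i: "i = d * e" ..
  with assms have e: "0 < e" by (simp add: zero_less_mult_iff)
  have ie: "i div d = e" using assms(1) i by simp
  define J where "J = {j. 0 < j \<and> j dvd e}"
  define X where "X A j = {xs \<in> permutations_of_set A. int (weight xs) = j}" for A j
  have "finite J"
    unfolding J_def using e by (auto intro!: finite_subset[where B = "{0..e}"] zdvd_imp_le)
  have "?S = (\<Union>j\<in>J. X C j \<times> X D (i div (d * j)))"
  proof (intro equalityI subsetI)
    fix p assume p: "p \<in> ?S"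
    obtain zs ys where p': "p = (zs, ys)" by (cases p)
    have eq: "e = int (weight zs) * int (weight ys)"
      using p assms(1) by (auto simp: p' i)
    then have "int (weight zs) \<in> J"
      using weight_pos[of zs] by (auto simp: J_def)
    moreover have "int (weight ys) = i div (d * int (weight zs))"
      using assms(1) weight_pos[of zs] by (simp add: i eq)
    ultimately show "p \<in> (\<Union>j\<in>J. X C j \<times> X D (i div (d * j)))"
      using p by (auto simp: p' X_def)
  next
    fix p assume "p \<in> (\<Union>j\<in>J. X C j \<times> X D (i div (d * j)))"
    then obtain j zs ys where j: "j \<in> J" and p: "p = (zs, ys)" "zs \<in> X C j" "ys \<in> X D (i div (d * j))"
      by auto
    \<comment> \<open>The division is exact because \<open>j\<close> divides \<open>e\<close>, so
      the two weights do multiply back to \<open>i\<close>.\<close>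
    from j have "d * j dvd i" by (auto simp: J_def i)
    then have "d * j * (i div (d * j)) = i" by simp
    then show "p \<in> ?S" using p by (auto simp: X_def)
  qed
  also have "card \<dots> = (\<Sum>j\<in>J. card (X C j \<times> X D (i div (d * j))))"
    using \<open>finite J\<close> by (intro card_UN_disjoint) (auto simp: X_def)
  finally show ?thesis
    using True by (simp add: card_cartesian_product X_def weight_count_def J_def ie)
qed

text \<open>After the largest letter is split off, \<open>C\<close> matters only through its size
  \<open>k\<close>. There are \<open>n choose k\<close> such sets, and \<open>d = k + 1\<close> is
  the spot of the largest letter.\<close>

lemma weight_count_recurrence:
  assumes "0 < i"
  shows "weight_count {1..Suc n} i =
    (\<Sum>d | 0 < d \<and> d dvd i.
       (n choose nat (d - 1)) *
       (\<Sum>j | 0 < j \<and> j dvd i div d.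
          weight_count {1..nat (d - 1)} j * weight_count {1..nat (int n + 1 - d)} (i div (d * j))))"
    (is "_ = (\<Sum>d | 0 < d \<and> d dvd i. ?F d)")
proof -
  define G where "G d = (\<Sum>j | 0 < j \<and> j dvd i div d.
    weight_count {1..nat (d - 1)} j * weight_count {1..nat (int n + 1 - d)} (i div (d * j)))" for d
  \<comment> \<open>The value 0 at non-divisors lets \<open>k\<close> run through all sizes before
    the sum is restricted to divisors of \<open>i\<close>.\<close>
  define h where "h k = (if int k + 1 dvd i then G (int k + 1) else 0)" for k
  have "weight_count {1..Suc n} i = weight_count (insert (Suc n) {1..n}) i"
    by (simp add: atLeastAtMostSuc_conv)
  also have "\<dots> = (\<Sum>C\<in>Pow {1..n}.
      card {(zs, ys) \<in> permutations_of_set C \<times> permutations_of_set ({1..n} - C).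
       (int (card C) + 1) * int (weight zs) * int (weight ys) = i})"
    by (rule weight_count_insert_max) auto
  also have "\<dots> = (\<Sum>C\<in>Pow {1..n}. h (card C))"
  proof (rule sum.cong)
    fix C assume "C \<in> Pow {1..n}"
    then have C: "C \<subseteq> {1..n}" by simp
    then have fin: "finite C" "finite ({1..n} - C)"
      using finite_subset by auto
    have "card ({1..n} - C) = nat (int n - int (card C))"
      using C fin by (simp add: card_Diff_subset)
    then have counts: "weight_count C j = weight_count {1..nat (int (card C) + 1 - 1)} j"
      "weight_count ({1..n} - C) j = weight_count {1..nat (int n + 1 - (int (card C) + 1))} j" for j
      using weight_count_eq[OF fin(1)] weight_count_eq[OF fin(2)] by simp_all
    have "0 < int (card C) + 1" by simp
    from card_weight_pairs[OF this assms, of C "{1..n} - C"]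
    show "card {(zs, ys) \<in> permutations_of_set C \<times> permutations_of_set ({1..n} - C).
       (int (card C) + 1) * int (weight zs) * int (weight ys) = i} = h (card C)"
      unfolding h_def G_def counts .
  qed simp
  also have "\<dots> = (\<Sum>k\<le>n. \<Sum>C\<in>{C \<in> Pow {1..n}. card C = k}. h (card C))"
    using card_mono[of "{1..n}"] by (intro sum.group[symmetric]) auto
  also have "\<dots> = (\<Sum>k\<le>n. (n choose k) * h k)"
  proof (rule sum.cong)
    fix k
    have "(\<Sum>C\<in>{C \<in> Pow {1..n}. card C = k}. h (card C)) = card {C \<in> Pow {1..n}. card C = k} * h k"
      by simp
    also have "card {C \<in> Pow {1..n}. card C = k} = n choose k"
      using n_subsets[of "{1..n}" k] by simp
    finally show "(\<Sum>C\<in>{C \<in> Pow {1..n}. card C = k}. h (card C)) = (n choose k) * h k" .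
  qed simp
  also have "\<dots> = (\<Sum>k | k \<le> n \<and> int k + 1 dvd i. ?F (int k + 1))"
    by (rule sum.mono_neutral_cong_right) (auto simp: h_def G_def)
  also have "\<dots> = (\<Sum>d\<in>(\<lambda>k. int k + 1) ` {k. k \<le> n \<and> int k + 1 dvd i}. ?F d)"
    by (subst sum.reindex) (auto simp: inj_on_def)
  also have "\<dots> = (\<Sum>d | 0 < d \<and> d dvd i. ?F d)"
  proof (rule sum.mono_neutral_left)
    show "finite {d. 0 < d \<and> d dvd i}"
      using assms by (auto intro!: finite_subset[where B = "{0..i}"] zdvd_imp_le)
    show "(\<lambda>k. int k + 1) ` {k. k \<le> n \<and> int k + 1 dvd i} \<subseteq> {d. 0 < d \<and> d dvd i}"
      by auto
    show "\<forall>d\<in>{d. 0 < d \<and> d dvd i} - (\<lambda>k. int k + 1) ` {k. k \<le> n \<and> int k + 1 dvd i}. ?F d = 0"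
    proof
      fix d assume d: "d \<in> {d. 0 < d \<and> d dvd i} - (\<lambda>k. int k + 1) ` {k. k \<le> n \<and> int k + 1 dvd i}"
      \<comment> \<open>Otherwise \<open>k = nat (d - 1)\<close> would put \<open>d\<close> into the
        image. Hence the binomial coefficient vanishes for these divisors.\<close>
      then have "n < nat (d - 1)"
        by (auto simp: image_iff not_le[symmetric] dest!: spec[of _ "nat (d - 1)"])
      then show "?F d = 0" by (simp add: binomial_eq_0)
    qed
  qed
  finally show ?thesis .
qed

section \<open>Fibres of the outcome map\<close>

text \<open>A new entry can only come from the update at the least empty spot from
  \<open>pref\<close> on.\<close>

lemma park_car_eq_Some:
  assumes "1 \<le> pref" "park_car n car pref st s = Some x" "st s \<noteq> Some x"
  shows "x = car" "s \<in> {1..n}" "st s = None"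
proof -
  let ?P = "\<lambda>s. pref \<le> s \<and> s \<le> n \<and> st s = None"
  have ex: "\<exists>s. ?P s"
    using assms(2,3) by (metis park_car_def)
  then have "?P (LEAST s. ?P s)" by (rule LeastI_ex)
  moreover have "park_car n car pref st = st((LEAST s. ?P s) \<mapsto> car)"
    unfolding park_car_def using ex by (rule if_P)
  then have "s = (LEAST s. ?P s)" "x = car"
    using assms(2,3) by (auto split: if_splits)
  ultimately show "x = car" "s \<in> {1..n}" "st s = None"
    using assms(1) by auto
qed

lemma park_car_mono:
  assumes "st s = Some x"
  shows "park_car n car pref st s = Some x"
proof (cases "\<exists>s. pref \<le> s \<and> s \<le> n \<and> st s = None")
  case True
  then have "st (LEAST s. pref \<le> s \<and> s \<le> n \<and> st s = None) = None"
    using LeastI_ex[OF True] by simp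
  then have "s \<noteq> (LEAST s. pref \<le> s \<and> s \<le> n \<and> st s = None)"
    using assms by auto
  then show ?thesis using assms by (simp add: park_car_def)
next
  case False
  then show ?thesis unfolding park_car_def by (simp only: if_False assms)
qed

lemma park_SomeD:
  assumes "\<forall>j\<in>{1..k}. 1 \<le> \<alpha> j" "park n \<alpha> k s = Some x"
  shows "x \<in> {1..k} \<and> s \<in> {1..n}"
  using assms
proof (induction k)
  case (Suc k)
  show ?case
  proof (cases "park n \<alpha> k s = Some x")
    case True
    then show ?thesis using Suc by auto
  next
    case False
    then show ?thesis
      using park_car_eq_Some[of "\<alpha> (Suc k)" n "Suc k" "park n \<alpha> k" s x] Suc.prems by auto
  qed
qed simp

text \<open>Later arrivals only add entries, and those carry indices above \<open>k\<close>. Every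
  intermediate state can thus be read off from the final one.\<close>

lemma park_eq_Some_iff:
  assumes "\<forall>j\<in>{1..k + l}. 1 \<le> \<alpha> j"
  shows "park n \<alpha> k s = Some x \<longleftrightarrow> park n \<alpha> (k + l) s = Some x \<and> x \<le> k"
  using assms
proof (induction l)
  case 0
  then show ?case using park_SomeD[of k \<alpha> n s x] by auto
next
  case (Suc l)
  have pos: "1 \<le> \<alpha> (Suc (k + l))" using Suc.prems by simp
  have "park n \<alpha> (k + l) s = Some x" if "park n \<alpha> (k + Suc l) s = Some x" "x \<le> k"
  proof (rule ccontr)
    assume "park n \<alpha> (k + l) s \<noteq> Some x"
    then have "x = Suc (k + l)" using park_car_eq_Some(1)[OF pos] that(1) by simp
    then show False using that(2) by simp
  qed
  moreover have "park n \<alpha> (k + Suc l) s = Some x" if "park n \<alpha> (k + l) s = Some x"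
    using park_car_mono[of "park n \<alpha> (k + l)" s x, OF that] by simp
  ultimately have "park n \<alpha> (k + l) s = Some x \<and> x \<le> k \<longleftrightarrow> park n \<alpha> (k + Suc l) s = Some x \<and> x \<le> k"
    by blast
  then show ?case using Suc by auto
qed

section \<open>Intermediate states and admissible preferences\<close>

definition partial_state :: "nat \<Rightarrow> (nat \<Rightarrow> nat) \<Rightarrow> nat \<Rightarrow> (nat \<rightharpoonup> nat)" where
  "partial_state n \<sigma> k = (\<lambda>s. if s \<in> {1..n} \<and> \<sigma> s \<le> k then Some (\<sigma> s) else None)"

text \<open>This replaces the condition on the outcome by one on every arrival: the final state
  determines the earlier ones through \<open>park_eq_Some_iff\<close>.\<close>

lemma outcome_fiber_iff_park:
  assumes "\<sigma> permutes {1..n}" "\<alpha> \<in> {1..n} \<rightarrow>\<^sub>E {1..n}"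
  shows "\<alpha> \<in> outcome_fiber n \<sigma> \<longleftrightarrow> (\<forall>k\<le>n. park n \<alpha> k = partial_state n \<sigma> k)"
proof
  assume fib: "\<alpha> \<in> outcome_fiber n \<sigma>"
  have pos: "\<forall>j\<in>{1..n}. 1 \<le> \<alpha> j"
    using assms(2) by (auto simp: PiE_iff)
  have sub: "Some ` {1..n} \<subseteq> park n \<alpha> n ` {1..n}"
    using fib by (force simp: outcome_fiber_def PF_def)
  \<comment> \<open>Pigeonhole: \<open>n\<close> cars occupy \<open>n\<close> spots, so no spot
    stays empty. This makes \<open>the\<close> in \<open>outcome\<close> meaningful.\<close>
  then have "park n \<alpha> n ` {1..n} = Some ` {1..n}"
    using card_image_le[of "{1..n}" "park n \<alpha> n"]
    by (intro card_seteq[symmetric]) (auto simp: card_image)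
  then have full: "park n \<alpha> n s \<noteq> None" if "s \<in> {1..n}" for s
    using that by (metis image_iff option.distinct(1))
  have final: "park n \<alpha> n s = Some x \<longleftrightarrow> s \<in> {1..n} \<and> \<sigma> s = x" for s x
  proof
    assume p: "park n \<alpha> n s = Some x"
    then have "s \<in> {1..n}" using park_SomeD[OF pos] by blast
    moreover have "outcome n \<alpha> s = \<sigma> s" using fib by (simp add: outcome_fiber_def)
    ultimately show "s \<in> {1..n} \<and> \<sigma> s = x" using p by (simp add: outcome_def)
  next
    assume s: "s \<in> {1..n} \<and> \<sigma> s = x"
    moreover have "outcome n \<alpha> s = \<sigma> s" using fib by (simp add: outcome_fiber_def)
    ultimately show "park n \<alpha> n s = Some x" using full[of s] by (auto simp: outcome_def)
  qed
  show "\<forall>k\<le>n. park n \<alpha> k = partial_state n \<sigma> k"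
  proof (intro allI impI ext)
    fix k s assume "k \<le> n"
    then have "park n \<alpha> k s = Some x \<longleftrightarrow> partial_state n \<sigma> k s = Some x" for x
      using park_eq_Some_iff[of k "n - k" \<alpha> n s x] pos final[of s x]
      by (auto simp: partial_state_def)
    then show "park n \<alpha> k s = partial_state n \<sigma> k s"
      by (metis option.exhaust)
  qed
next
  assume "\<forall>k\<le>n. park n \<alpha> k = partial_state n \<sigma> k"
  then have p: "park n \<alpha> n = partial_state n \<sigma> n" by simp
  have in_range: "\<sigma> s \<in> {1..n}" if "s \<in> {1..n}" for s
    using that permutes_in_image[OF assms(1)] by blast
  have "\<exists>s\<in>{1..n}. park n \<alpha> n s = Some car" if "car \<in> {1..n}" for car
  proof -
    from that obtain s where "s \<in> {1..n}" "car = \<sigma> s"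
      using permutes_image[OF assms(1)] by blast
    then show ?thesis using that by (auto simp: p partial_state_def)
  qed
  moreover have "outcome n \<alpha> s = \<sigma> s" for s
    using in_range[of s] permutes_not_in[OF assms(1), of s]
    by (auto simp: outcome_def p partial_state_def)
  ultimately show "\<alpha> \<in> outcome_fiber n \<sigma>"
    using assms(2) by (auto simp: outcome_fiber_def PF_def)
qed

text \<open>The starts of the blocks that end in \<open>p\<close>. They form an interval ending in
  \<open>p\<close>, so their number is the length of the longest block.\<close>

definition run :: "(nat \<Rightarrow> nat) \<Rightarrow> nat \<Rightarrow> nat set" where
  "run \<sigma> p = {a \<in> {1..p}. \<forall>q\<in>{a..p}. \<sigma> q \<le> \<sigma> p}"

text \<open>Before car \<open>Suc k\<close> arrives, the occupied spots are those with value at most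
  \<open>k\<close>. It reaches \<open>p\<close> exactly if all spots from \<open>a\<close> up to
  just before \<open>p\<close> are occupied.\<close>

lemma park_car_partial_state_iff:
  assumes "\<sigma> permutes {1..n}" "p \<in> {1..n}" "\<sigma> p = Suc k" "1 \<le> a"
  shows "park_car n (Suc k) a (partial_state n \<sigma> k) = partial_state n \<sigma> (Suc k) \<longleftrightarrow> a \<in> run \<sigma> p"
proof -
  let ?st = "partial_state n \<sigma> k"
  let ?P = "\<lambda>s. a \<le> s \<and> s \<le> n \<and> ?st s = None"
  have inj: "s = p" if "\<sigma> s = Suc k" for s
    using that assms(3) permutes_inj[OF assms(1)] by (metis injD)
  have st: "partial_state n \<sigma> (Suc k) = ?st(p \<mapsto> Suc k)"
  proof
    fix s
    show "partial_state n \<sigma> (Suc k) s = (?st(p \<mapsto> Suc k)) s"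
    proof (cases "s = p")
      case True
      then show ?thesis using assms(2,3) by (simp add: partial_state_def)
    next
      case False
      with inj have "\<sigma> s \<noteq> Suc k" by blast
      with False show ?thesis by (simp add: partial_state_def le_Suc_eq)
    qed
  qed
  have p: "?st p = None" using assms(3) by (simp add: partial_state_def)
  have full: "?st q \<noteq> None \<longleftrightarrow> \<sigma> q \<le> k" if "1 \<le> q" "q \<le> n" for q
    using that by (simp add: partial_state_def)
  show ?thesis
  proof
    assume a: "a \<in> run \<sigma> p"
    have "?P p" using a p assms(2) by (auto simp: run_def)
    moreover have "p \<le> s" if s: "?P s" for s
    proof (rule ccontr)
      assume "\<not> p \<le> s"
      \<comment> \<open>Membership in \<open>run\<close> allows the value \<open>Suc k\<close>, but
        injectivity confines it to \<open>p\<close>; so \<open>s\<close> would be occupied.\<close>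
      then have "\<sigma> s \<le> Suc k" "s \<noteq> p" using a s assms(3) by (auto simp: run_def)
      moreover from \<open>s \<noteq> p\<close> inj have "\<sigma> s \<noteq> Suc k" by blast
      ultimately have "\<sigma> s \<le> k" by simp
      then show False using full[of s] s assms(4) by simp
    qed
    ultimately have "(LEAST s. ?P s) = p" "\<exists>s. ?P s"
      by (auto intro!: Least_equality)
    then show "park_car n (Suc k) a ?st = partial_state n \<sigma> (Suc k)"
      by (simp add: park_car_def st)
  next
    assume eq: "park_car n (Suc k) a ?st = partial_state n \<sigma> (Suc k)"
    \<comment> \<open>As \<open>p\<close> was empty before, its new entry shows that the car parked
      and that \<open>p\<close> is the least empty spot.\<close>
    then have upd: "park_car n (Suc k) a ?st p = Some (Suc k)" by (simp add: st)
    then have ex: "\<exists>s. ?P s" using p by (auto simp: park_car_def split: if_splits)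
    with upd p have least: "(LEAST s. ?P s) = p"
      by (auto simp: park_car_def split: if_splits)
    have "a \<le> p" using LeastI_ex[OF ex] unfolding least by simp
    moreover have "\<sigma> q \<le> \<sigma> p" if "q \<in> {a..p}" for q
    proof (cases "q = p")
      case False
      with that have "q < p" by simp
      then have "\<not> ?P q" using not_less_Least[of q ?P] unfolding least by simp
      then show ?thesis
        using full[of q] that assms(2-4) by auto
    qed simp
    ultimately show "a \<in> run \<sigma> p" using assms(4) by (simp add: run_def)
  qed
qed

text \<open>Once the earlier states are the prescribed ones, the next arrival constrains only its
  own preference, so the choices are independent.\<close>

lemma outcome_fiber_eq_PiE:
  assumes "\<sigma> permutes {1..n}"
  shows "outcome_fiber n \<sigma> = (\<Pi>\<^sub>E car\<in>{1..n}. run \<sigma> (inv \<sigma> car))"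
proof -
  have inv: "inv \<sigma> x \<in> {1..n}" "\<sigma> (inv \<sigma> x) = x" if "x \<in> {1..n}" for x
    using that permutes_in_image[OF permutes_inv[OF assms]] permutes_inverses(1)[OF assms] by auto
  have run: "run \<sigma> (inv \<sigma> x) \<subseteq> {1..n}" if "x \<in> {1..n}" for x
    using inv(1)[OF that] by (auto simp: run_def)
  have iff: "\<alpha> \<in> outcome_fiber n \<sigma> \<longleftrightarrow> (\<forall>car\<in>{1..n}. \<alpha> car \<in> run \<sigma> (inv \<sigma> car))"
    if \<alpha>: "\<alpha> \<in> {1..n} \<rightarrow>\<^sub>E {1..n}" for \<alpha>
  proof -
    have step: "park_car n (Suc k) (\<alpha> (Suc k)) (partial_state n \<sigma> k) = partial_state n \<sigma> (Suc k)
        \<longleftrightarrow> \<alpha> (Suc k) \<in> run \<sigma> (inv \<sigma> (Suc k))" if "k < n" for k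
    proof (rule park_car_partial_state_iff[OF assms])
      have "Suc k \<in> {1..n}" using that by simp
      then show "inv \<sigma> (Suc k) \<in> {1..n}" "\<sigma> (inv \<sigma> (Suc k)) = Suc k" "1 \<le> \<alpha> (Suc k)"
        using inv \<alpha> PiE_mem[OF \<alpha>] by auto
    qed
    \<comment> \<open>The values of \<open>\<sigma>\<close> on \<open>{1..n}\<close> are at least 1,
      so no car has index at most 0.\<close>
    have zero: "partial_state n \<sigma> 0 = Map.empty"
    proof
      fix s
      show "partial_state n \<sigma> 0 s = None"
        using permutes_in_image[OF assms, of s] by (auto simp: partial_state_def)
    qed
    have "(\<forall>k\<le>n. park n \<alpha> k = partial_state n \<sigma> k) \<longleftrightarrow>
        (\<forall>k<n. \<alpha> (Suc k) \<in> run \<sigma> (inv \<sigma> (Suc k)))"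
    proof
      assume "\<forall>k\<le>n. park n \<alpha> k = partial_state n \<sigma> k"
      then show "\<forall>k<n. \<alpha> (Suc k) \<in> run \<sigma> (inv \<sigma> (Suc k))"
        using step by (metis Suc_leI less_imp_le park.simps(2))
    next
      assume R: "\<forall>k<n. \<alpha> (Suc k) \<in> run \<sigma> (inv \<sigma> (Suc k))"
      have "park n \<alpha> k = partial_state n \<sigma> k" if "k \<le> n" for k
        using that by (induction k) (use zero step R in auto)
      then show "\<forall>k\<le>n. park n \<alpha> k = partial_state n \<sigma> k" by blast
    qed
    also have "\<dots> \<longleftrightarrow> (\<forall>car\<in>{1..n}. \<alpha> car \<in> run \<sigma> (inv \<sigma> car))"
      by (metis One_nat_def Suc_le_eq Suc_pred atLeastAtMost_iff le_simps(2) zero_less_Suc)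
    finally show ?thesis using outcome_fiber_iff_park[OF assms \<alpha>] by simp
  qed
  show ?thesis
  proof (intro equalityI subsetI)
    fix \<alpha> assume fib: "\<alpha> \<in> outcome_fiber n \<sigma>"
    then have \<alpha>: "\<alpha> \<in> {1..n} \<rightarrow>\<^sub>E {1..n}" by (simp add: outcome_fiber_def PF_def)
    with fib iff show "\<alpha> \<in> (\<Pi>\<^sub>E car\<in>{1..n}. run \<sigma> (inv \<sigma> car))"
      unfolding PiE_iff by blast
  next
    fix \<alpha> assume pi: "\<alpha> \<in> (\<Pi>\<^sub>E car\<in>{1..n}. run \<sigma> (inv \<sigma> car))"
    moreover have "\<dots> \<subseteq> {1..n} \<rightarrow>\<^sub>E {1..n}"
      using run by (intro PiE_mono)
    ultimately have "\<alpha> \<in> {1..n} \<rightarrow>\<^sub>E {1..n}" by blast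
    with pi iff show "\<alpha> \<in> outcome_fiber n \<sigma>"
      unfolding PiE_iff by blast
  qed
qed

section \<open>Fibre sizes as weights of words\<close>

lemma card_suffix_eq_length_takeWhile:
  "card {a \<in> {1..k}. \<forall>q\<in>{a..k}. P q} = length (takeWhile P (rev [1..<Suc k]))"
proof (induction k)
  case (Suc k)
  \<comment> \<open>Every interval up to \<open>Suc k\<close> contains \<open>Suc k\<close>: if
    \<open>P\<close> holds there, this spot joins the earlier starts; otherwise no start
    survives.\<close>
  show ?case
  proof (cases "P (Suc k)")
    case True
    then have "{a \<in> {1..Suc k}. \<forall>q\<in>{a..Suc k}. P q} = insert (Suc k) {a \<in> {1..k}. \<forall>q\<in>{a..k}. P q}"
      by (auto simp: le_Suc_eq)
    then show ?thesis using Suc True by simp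
  next
    case False
    then have "{a \<in> {1..Suc k}. \<forall>q\<in>{a..Suc k}. P q} = {}" by auto
    then show ?thesis using False by simp
  qed
qed simp

text \<open>Reversal puts the last spot first, so its block becomes the prefix measured by
  \<open>weight\<close>.\<close>

lemma prod_card_run: "(\<Prod>p\<in>{1..n}. card (run \<sigma> p)) = weight (map \<sigma> (rev [1..<Suc n]))"
proof (induction n)
  case (Suc n)
  have "card (run \<sigma> (Suc n)) = Suc (length (takeWhile (\<lambda>y. y \<le> \<sigma> (Suc n)) (map \<sigma> (rev [1..<Suc n]))))"
    unfolding run_def card_suffix_eq_length_takeWhile by (simp add: takeWhile_map o_def)
  then show ?case using Suc by (simp del: mult_Suc add: mult.commute)
qed simp

lemma card_outcome_fiber:
  assumes "\<sigma> permutes {1..n}"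
  shows "card (outcome_fiber n \<sigma>) = weight (map \<sigma> (rev [1..<Suc n]))"
proof -
  have "card (outcome_fiber n \<sigma>) = (\<Prod>car\<in>{1..n}. card (run \<sigma> (inv \<sigma> car)))"
    by (simp add: outcome_fiber_eq_PiE[OF assms] card_PiE)
  also have "\<dots> = (\<Prod>p\<in>{1..n}. card (run \<sigma> p))"
    \<comment> \<open>Cars are reindexed by their final spots.\<close>
    by (rule prod.permute[OF permutes_inv[OF assms], of "\<lambda>p. card (run \<sigma> p)", unfolded o_def, symmetric])
  finally show ?thesis by (simp only: prod_card_run)
qed

text \<open>Injectivity holds because permutations agree outside \<open>{1..n}\<close>; surjectivity
  follows by counting, both sides having \<open>n!\<close> elements.\<close>

lemma bij_betw_permutes_permutations_of_set:
  "bij_betw (\<lambda>\<sigma>. map \<sigma> (rev [1..<Suc n])) {\<sigma>. \<sigma> permutes {1..n}} (permutations_of_set {1..n})"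
proof -
  let ?f = "\<lambda>\<sigma>. map \<sigma> (rev [1..<Suc n])"
  let ?P = "{\<sigma>. \<sigma> permutes {1..n}}"
  have set: "set (rev [1..<Suc n]) = {1..n}" by auto
  have inj: "inj_on ?f ?P"
  proof (rule inj_onI, rule ext)
    fix \<sigma> \<tau> x assume *: "\<sigma> \<in> ?P" "\<tau> \<in> ?P" "?f \<sigma> = ?f \<tau>"
    then have "\<forall>x\<in>{1..n}. \<sigma> x = \<tau> x"
      unfolding map_eq_conv set by blast
    then show "\<sigma> x = \<tau> x"
      using * by (cases "x \<in> {1..n}") (auto simp: permutes_not_in)
  qed
  moreover have "?f ` ?P = permutations_of_set {1..n}"
  proof (rule card_subset_eq)
    show "?f ` ?P \<subseteq> permutations_of_set {1..n}"
    proof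
      fix xs assume "xs \<in> ?f ` ?P"
      then obtain \<sigma> where \<sigma>: "\<sigma> permutes {1..n}" "xs = ?f \<sigma>" by auto
      have "set xs = {1..n}"
        unfolding \<sigma>(2) set_map set by (rule permutes_image[OF \<sigma>(1)])
      moreover have "distinct xs"
        unfolding \<sigma>(2) distinct_map using permutes_inj_on[OF \<sigma>(1)] by simp
      ultimately show "xs \<in> permutations_of_set {1..n}" by (simp add: permutations_of_set_def)
    qed
    show "card (?f ` ?P) = card (permutations_of_set {1..n})"
      using inj by (simp add: card_image card_permutations[where n = n])
  qed simp
  ultimately show ?thesis by (simp add: bij_betw_def)
qed

lemma c_eq_weight_count: "c (int n) i = weight_count {1..n} i"
proof -
  let ?f = "\<lambda>\<sigma>. map \<sigma> (rev [1..<Suc n])"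
  let ?S = "{\<sigma>. \<sigma> permutes {1..n} \<and> int (weight (?f \<sigma>)) = i}"
  note bij = bij_betw_permutes_permutations_of_set[of n]
  have "c (int n) i = card ?S"
    unfolding c_def by (auto simp: card_outcome_fiber simp del: upt_Suc intro!: arg_cong[where f = card])
  also have "\<dots> = card (?f ` ?S)"
    using bij by (intro card_image[symmetric]) (auto simp: bij_betw_def intro: inj_on_subset)
  also have "?f ` ?S = {xs \<in> permutations_of_set {1..n}. int (weight xs) = i}"
    using bij_betw_imp_surj_on[OF bij, symmetric] by (auto simp del: upt_Suc)
  finally show ?thesis by (simp add: weight_count_def)
qed

section \<open>Transfer of the recurrence to \<open>c\<close>, and its vanishing outside the
  range\<close>

theorem proposition4p1:
  fixes n :: int
  assumes "n \<ge> 1"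
  shows "(\<forall>i::int. 1 \<le> i \<and> i \<le> fact (nat n) \<longrightarrow>
            c n i =
              (\<Sum>d | 0 < d \<and> d dvd i.
                 (nat (n - 1) choose nat (d - 1)) *
                 (\<Sum>j | 0 < j \<and> j dvd i div d. c (d - 1) j * c (n - d) (i div (d * j))))) \<and>
         (\<forall>i::int. \<not> (1 \<le> i \<and> i \<le> fact (nat n)) \<longrightarrow> c n i = 0)"
proof (intro conjI allI impI)
  obtain m where n: "n = int (Suc m)"
    using assms by (metis Suc_pred nat_0_le zero_less_nat_eq int_one_le_iff_zero_less zero_le_one order.trans)
  have count: "weight_count {1..nat k} j = c k j" if "0 \<le> k" for k j
    using that c_eq_weight_count[of "nat k" j] by simp
  fix i :: int
  {
    assume "1 \<le> i \<and> i \<le> fact (nat n)"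
    then have "0 < i" by simp
    have "c n i = weight_count {1..Suc m} i"
      by (simp only: n c_eq_weight_count)
    also have "\<dots> = (\<Sum>d | 0 < d \<and> d dvd i.
       (m choose nat (d - 1)) *
       (\<Sum>j | 0 < j \<and> j dvd i div d.
          weight_count {1..nat (d - 1)} j * weight_count {1..nat (int m + 1 - d)} (i div (d * j))))"
      using \<open>0 < i\<close> by (rule weight_count_recurrence)
    also have "\<dots> = (\<Sum>d | 0 < d \<and> d dvd i.
                 (nat (n - 1) choose nat (d - 1)) *
                 (\<Sum>j | 0 < j \<and> j dvd i div d. c (d - 1) j * c (n - d) (i div (d * j))))"
    proof (rule sum.cong)
      fix d assume "d \<in> {d. 0 < d \<and> d dvd i}"
      then have d: "0 < d" by simp
      show "(m choose nat (d - 1)) *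
       (\<Sum>j | 0 < j \<and> j dvd i div d.
          weight_count {1..nat (d - 1)} j * weight_count {1..nat (int m + 1 - d)} (i div (d * j))) =
        (nat (n - 1) choose nat (d - 1)) *
                 (\<Sum>j | 0 < j \<and> j dvd i div d. c (d - 1) j * c (n - d) (i div (d * j)))"
      \<comment> \<open>For \<open>d > n\<close> the two inner sums may differ, since
        \<open>nat\<close> turns the negative size into 0 while \<open>c\<close> is 0 there. The
        binomial coefficient is 0 in that case.\<close>
      proof (cases "d \<le> n")
        case True
        have "int m + 1 - d = n - d" "nat (n - 1) = m" using n by auto
        then show ?thesis using True d count[of "d - 1"] count[of "n - d"] by simp
      next
        case False
        then show ?thesis by (simp add: n binomial_eq_0)
      qed
    qed simp
    finally show "c n i = (\<Sum>d | 0 < d \<and> d dvd i.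
                 (nat (n - 1) choose nat (d - 1)) *
                 (\<Sum>j | 0 < j \<and> j dvd i div d. c (d - 1) j * c (n - d) (i div (d * j))))" .
  }
  {
    assume i: "\<not> (1 \<le> i \<and> i \<le> fact (nat n))"
    \<comment> \<open>All weights lie between 1 and \<open>fact (nat n)\<close>.\<close>
    have "int (weight xs) \<noteq> i" if "xs \<in> permutations_of_set {1..nat n}" for xs
    proof -
      have "length xs = nat n"
        using that by (auto simp: permutations_of_set_def dest!: distinct_card)
      then have "weight xs \<le> fact (nat n)" using weight_le_fact[of xs] by simp
      then have "int (weight xs) \<le> fact (nat n)"
        by (metis of_nat_fact of_nat_le_iff)
      then show ?thesis using i weight_pos[of xs] by auto
    qed
    then have "weight_count {1..nat n} i = 0" by (simp add: weight_count_def)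
    then show "c n i = 0" using assms count[of n i] by simp
  }
qed

end
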